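(* Let $p\in(0,1)$ and let $(X_n)_{n\in\mathbb{Z}}$ be a stationary, strongly mixing sequence of real-valued random variables with distribution function $F$ and strong mixing coefficients $\alpha(n)$. Let $t_p=F^{-1}(p)$. Assume that for some $\rho>0$ and some $M\neq 0$ $$F(t_p+h)-F(t_p)=M|h|^\rho\operatorname{sgn}(h)+o(|h|^\rho)\quad\text{as }h\to 0,$$ and that $\sum_{n=1}^\infty\alpha(n)<\infty$. Then $$F_n^{-1}(p)-t_p=\left(\frac{|p-F_n(t_p)|}{M}\right)^{1/\rho}\operatorname{sgn}\bigl(p-F_n(t_p)\bigr)+R_n,$$ where $R_n=o_P(n^{-1/(2\rho)})$, i.e. $n^{1/(2\rho)}R_n\to 0$ in probability as $n\to\infty$.
   Context: For a distribution function $G$ and $p\in(0,1)$, the $p$-quantile is $G^{-1}(p):=\inf\{t\in\mathbb{R}: G(t)\ge p\}$. The empirical distribution function is $F_n(t):=\frac1n\sum_{i=1}^n \mathbf{1}_{\{X_i\le t\}}$, and $F_n^{-1}(p)$ is its $p$-quantile (the empirical $p$-quantile). The strong mixing coefficients are $$\alpha(k):=\sup\{|P(A\cap B)-P(A)P(B)|: A\in\mathcal{F}_1^n,\ B\in\mathcal{F}_{n+k}^\infty,\ n\in\mathbb{Z}\},$$ where $\mathcal{F}_a^l$ is the $\sigma$-field generated by $X_a,\ldots,X_l$ (trivial if $l<a$); the sequence is strongly mixing if $\alpha(k)\to 0$ as $k\to\infty$. Convention: $\operatorname{sgn}(0)=0$. (Since $F$ is nondecreasing, $M\ne 0$ forces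 $M>0$.) *)

theory Defs
  imports "HOL-Probability.Probability" "HOL-Library.Landau_Symbols"
begin

definition quantile :: "(real \<Rightarrow> real) \<Rightarrow> real \<Rightarrow> real" where
  "quantile G p = Inf {t. G t \<ge> p}"

definition empirical_cdf :: "(int \<Rightarrow> 'a \<Rightarrow> real) \<Rightarrow> nat \<Rightarrow> 'a \<Rightarrow> real \<Rightarrow> real" where
  "empirical_cdf X n \<omega> t = (1 / real n) * (\<Sum>i = 1..n. indicator {..t} (X (int i) \<omega>))"

(* Equality of the laws of the whole path and of all its time shifts, i.e. strict stationarity. *)
definition strictly_stationary :: "'a measure \<Rightarrow> (int \<Rightarrow> 'a \<Rightarrow> real) \<Rightarrow> bool" where
  "strictly_stationary P X \<longleftrightarrow>
     (\<forall>k::int. distr P (\<Pi>\<^sub>M i\<in>UNIV. borel) (\<lambda>\<omega> i. X (i + k) \<omega>) =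
                distr P (\<Pi>\<^sub>M i\<in>UNIV. borel) (\<lambda>\<omega> i. X i \<omega>))"

(* The events of the sigma-field generated by X i for i in I; for empty I these are only
   the empty set and the whole space. *)
definition gen_events :: "'a measure \<Rightarrow> (int \<Rightarrow> 'a \<Rightarrow> real) \<Rightarrow> int set \<Rightarrow> 'a set set" where
  "gen_events P X I =
     sigma_sets (space P) {X i -` S \<inter> space P | i S. i \<in> I \<and> S \<in> sets borel}"

definition mixing_coeff :: "'a measure \<Rightarrow> (int \<Rightarrow> 'a \<Rightarrow> real) \<Rightarrow> nat \<Rightarrow> real" where
  "mixing_coeff P X k =
     Sup {\<bar>measure P (A \<inter> B) - measure P A * measure P B\<bar> | A B n.
            A \<in> gen_events P X {1..n} \<and> B \<in> gen_events P X {n + int k..}}"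

definition strongly_mixing :: "'a measure \<Rightarrow> (int \<Rightarrow> 'a \<Rightarrow> real) \<Rightarrow> bool" where
  "strongly_mixing P X \<longleftrightarrow> mixing_coeff P X \<longlonglongrightarrow> 0"

(* Measurability is part of the definition: measure P is 0 on non-measurable sets, so the
   limit condition alone could hold vacuously. *)
definition tendsto_in_prob ::
    "'a measure \<Rightarrow> (nat \<Rightarrow> 'a \<Rightarrow> real) \<Rightarrow> ('a \<Rightarrow> real) \<Rightarrow> bool" where
  "tendsto_in_prob P Y Z \<longleftrightarrow>
     (\<forall>n. Y n \<in> borel_measurable P) \<and> Z \<in> borel_measurable P \<and>
     (\<forall>\<epsilon>>0. (\<lambda>n. measure P {\<omega> \<in> space P. \<bar>Y n \<omega> - Z \<omega>\<bar> > \<epsilon>}) \<longlonglongrightarrow> 0)"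

end

theory Submission
  imports Defs
begin

text \<open>Put \<open>U n = n powr (1 / (2 * \<rho>)) * (quantile - t\<^sub>p)\<close>, \<open>V n = sqrt n * (p - F\<^sub>n t\<^sub>p)\<close> and
  \<open>W x n = sqrt n * (F\<^sub>n (t\<^sub>p + x * n powr (- 1 / (2 * \<rho>))) - F\<^sub>n t\<^sub>p)\<close>. Inverting the empirical
  distribution function gives \<open>U n \<le> x \<longleftrightarrow> V n \<le> W x n\<close>. Summability of the mixing coefficients
  bounds the variance of \<open>V n\<close>, and by dominated convergence the variance of \<open>W x n\<close> tends to 0, so
  \<open>W x n\<close> tends in probability to the limit \<open>g x = M * \<bar>x\<bar> powr \<rho> * sgn x\<close> of its mean. Ghosh's
  argument for the Bahadur representation then shows that \<open>U n\<close> is close to \<open>g\<^sup>-\<^sup>1 (V n)\<close>.\<close>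

section \<open>Quantiles\<close>

text \<open>Right continuity puts the infimum itself into the set \<open>{t. p \<le> G t}\<close>,
  which by monotonicity is then a closed half-line. The points \<open>a\<close> and \<open>b\<close>
  make this set bounded below and nonempty, so that \<open>Inf\<close> is a genuine infimum.\<close>

lemma quantile_le_iff:
  fixes G :: "real \<Rightarrow> real"
  assumes "mono G" and rc: "\<And>t. continuous (at_right t) G"
    and "G a < p" and "p \<le> G b"
  shows "quantile G p \<le> x \<longleftrightarrow> p \<le> G x"
proof -
  let ?S = "{t. p \<le> G t}"
  have lower: "a \<le> t" if "t \<in> ?S" for t
    using that \<open>G a < p\<close> monoD[OF \<open>mono G\<close>, of t a] by force
  have bdd: "bdd_below ?S"
    using lower by (rule bdd_belowI)
  have ne: "?S \<noteq> {}"
    using \<open>p \<le> G b\<close> by auto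
  have "p \<le> G (Inf ?S)"
  proof (rule tendsto_lowerbound)
    show "(G \<longlongrightarrow> G (Inf ?S)) (at_right (Inf ?S))"
      using rc by (simp add: continuous_within)
    have "p \<le> G t" if lt: "Inf ?S < t" for t
    proof -
      obtain s where "s \<in> ?S" "s < t"
        using lt cInf_less_iff[OF ne bdd, of t] by blast
      then show ?thesis
        using monoD[OF \<open>mono G\<close>, of s t] by auto
    qed
    then show "\<forall>\<^sub>F t in at_right (Inf ?S). p \<le> G t"
      by (auto simp: eventually_at_filter)
  qed simp
  then show ?thesis
    unfolding quantile_def
    using cInf_lower[OF _ bdd, of x] monoD[OF \<open>mono G\<close>, of "Inf ?S" x] by auto
qed

text \<open>A cdf may jump over \<open>p\<close> at its quantile. To the left of the quantile its
  values are below \<open>p\<close>, so left continuity there rules the jump out.\<close>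

lemma cdf_quantile_eq:
  assumes "real_distribution D" and "0 < p" "p < 1"
    and cont: "isCont (cdf D) (quantile (cdf D) p)"
  shows "cdf D (quantile (cdf D) p) = p"
proof (rule antisym)
  interpret real_distribution D by fact
  let ?t = "quantile (cdf D) p"
  have "\<exists>a. cdf D a < p"
    using order_tendstoD(2)[OF cdf_lim_at_bot \<open>0 < p\<close>]
    by (auto simp: eventually_at_bot_linorder)
  moreover have "\<exists>b. p \<le> cdf D b"
    using order_tendstoD(1)[OF cdf_lim_at_top_prob \<open>p < 1\<close>]
    by (auto simp: eventually_at_top_linorder intro: less_imp_le)
  ultimately have iff: "?t \<le> x \<longleftrightarrow> p \<le> cdf D x" for x
    using quantile_le_iff cdf_nondecreasing cdf_is_right_cont unfolding mono_def by metis
  show "p \<le> cdf D ?t"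
    using iff[of ?t] by simp
  show "cdf D ?t \<le> p"
  proof (rule tendsto_upperbound)
    show "(cdf D \<longlongrightarrow> cdf D ?t) (at_left ?t)"
      using cont by (simp add: isCont_def filterlim_at_split)
    have "cdf D t \<le> p" if "t < ?t" for t
      using iff[of t] that by linarith
    then show "\<forall>\<^sub>F t in at_left ?t. cdf D t \<le> p"
      by (auto simp: eventually_at_filter)
  qed simp
qed

lemma empirical_cdf_mono: "mono (empirical_cdf X n \<omega>)"
  unfolding empirical_cdf_def mono_def
  by (intro allI impI mult_left_mono sum_mono) (auto simp: indicator_def)

lemma empirical_cdf_right_cont: "continuous (at_right t) (empirical_cdf X n \<omega>)"
proof -
  have "((\<lambda>s. indicator {..s} y :: real) \<longlongrightarrow> indicator {..t} y) (at_right t)" for y :: real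
  proof (rule tendsto_eventually)
    show "\<forall>\<^sub>F s in at_right t. indicator {..s} y = (indicator {..t} y :: real)"
    proof (cases "y \<le> t")
      case True
      then show ?thesis
        by (auto simp: eventually_at_filter indicator_def)
    next
      case False
      then show ?thesis
        by (auto simp: eventually_at_right_field indicator_def intro!: exI[of _ y])
    qed
  qed
  then show ?thesis
    unfolding continuous_within empirical_cdf_def by (intro tendsto_intros)
qed

lemma empirical_quantile_le_iff:
  assumes "0 < p" "p \<le> 1" "n \<ge> 1"
  shows "quantile (empirical_cdf X n \<omega>) p \<le> x \<longleftrightarrow> p \<le> empirical_cdf X n \<omega> x"
proof (rule quantile_le_iff[OF empirical_cdf_mono empirical_cdf_right_cont])
  \<comment> \<open>Just below the sample minimum the empirical cdf is 0, and at the sample maximum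
    it is 1. For \<open>n = 0\<close> it would vanish everywhere and never reach
    \<open>p\<close>.\<close>
  let ?Y = "(\<lambda>i. X (int i) \<omega>) ` {1..n}"
  have "Min ?Y \<le> X (int i) \<omega>" if "i \<in> {1..n}" for i
    using that by (intro Min_le) auto
  then have "\<forall>i\<in>{1..n}. \<not> X (int i) \<omega> \<le> Min ?Y - 1"
    by fastforce
  then have "(\<Sum>i = 1..n. indicator {..Min ?Y - 1} (X (int i) \<omega>)) = (0::real)"
    by (intro sum.neutral) (auto simp: indicator_def)
  then show "empirical_cdf X n \<omega> (Min ?Y - 1) < p"
    using \<open>0 < p\<close> by (simp add: empirical_cdf_def)
  have "(\<Sum>i = 1..n. indicator {..Max ?Y} (X (int i) \<omega>)) = (\<Sum>i = 1..n. 1::real)"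
    by (intro sum.cong) (auto simp: indicator_def)
  then show "p \<le> empirical_cdf X n \<omega> (Max ?Y)"
    using assms by (simp add: empirical_cdf_def)
qed

section \<open>Variance of empirical frequencies under strong mixing\<close>

text \<open>The conditional expresses the distance of \<open>i\<close> and \<open>j\<close> under
  truncated subtraction. Every distance below \<open>n\<close> occurs at most once on each side of
  \<open>i\<close>, hence the factor 2.\<close>

lemma sum_distance_le:
  fixes c :: "nat \<Rightarrow> real"
  assumes "\<And>k. 0 \<le> c k" "i \<le> n" "1 \<le> i"
  shows "(\<Sum>j = 1..n. c (if i \<le> j then j - i else i - j)) \<le> 2 * (\<Sum>k<n. c k)"
proof -
  let ?d = "\<lambda>j. c (if i \<le> j then j - i else i - j)"
  have "sum ?d {1..n} = sum ?d {1..<i} + sum ?d {i..n}"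
    using assms by (subst sum.union_disjoint[symmetric]) (auto intro: sum.cong)
  also have "sum ?d {1..<i} = sum c ((\<lambda>j. i - j) ` {1..<i})"
    by (subst sum.reindex) (auto simp: inj_on_def intro!: sum.cong)
  also have "\<dots> \<le> (\<Sum>k<n. c k)"
    using assms by (intro sum_mono2) auto
  also have "sum ?d {i..n} = sum c ((\<lambda>j. j - i) ` {i..n})"
    by (subst sum.reindex) (auto simp: inj_on_def intro!: sum.cong)
  also have "\<dots> \<le> (\<Sum>k<n. c k)"
    using assms by (intro sum_mono2) auto
  finally show ?thesis by simp
qed

text \<open>A real \<open>Sup\<close> dominates its members only when the set is bounded above; here
  1 is a bound, as both terms of the difference lie between 0 and 1.\<close>

lemma (in prob_space) mixing_bound:
  assumes X: "\<And>i. X i \<in> borel_measurable M"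
    and A: "A \<in> gen_events M X {1..m}" and B: "B \<in> gen_events M X {m + int k..}"
  shows "\<bar>prob (A \<inter> B) - prob A * prob B\<bar> \<le> mixing_coeff M X k"
  unfolding mixing_coeff_def
proof (rule cSup_upper)
  show "bdd_above {\<bar>prob (A \<inter> B) - prob A * prob B\<bar> | A B n.
      A \<in> gen_events M X {1..n} \<and> B \<in> gen_events M X {n + int k..}}"
  proof (rule bdd_aboveI, safe)
    fix A B
    have "prob (A \<inter> B) \<le> 1" "0 \<le> prob (A \<inter> B)"
      "prob A * prob B \<le> 1 * 1" "0 \<le> prob A * prob B"
      by (intro mult_mono | simp)+
    then show "\<bar>prob (A \<inter> B) - prob A * prob B\<bar> \<le> 1" by linarith
  qed
qed (use A B in blast)

text \<open>The argument works with second moments: the common law \<open>D\<close> fixes the means,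
  and the summable coefficients control the covariances.\<close>

locale mixing_sequence = prob_space M for M :: "'a measure" +
  fixes X :: "int \<Rightarrow> 'a \<Rightarrow> real" and D :: "real measure"
  assumes rv [measurable]: "\<And>i. X i \<in> borel_measurable M"
    and distr: "\<And>i. distr M borel (X i) = D"
    and summable_mixing: "summable (\<lambda>n. mixing_coeff M X (Suc n))"
begin

sublocale D: real_distribution D
  using distr rv real_distribution_distr by metis

text \<open>The empirical measure of \<open>S\<close>. Half-lines give the empirical cdf and
  half-open intervals its increments, so a single deviation bound serves both \<open>V n\<close> and
  \<open>W x n\<close>.\<close>

definition freq :: "nat \<Rightarrow> real set \<Rightarrow> 'a \<Rightarrow> real" where
  "freq n S \<omega> = (1 / real n) * (\<Sum>i = 1..n. indicator S (X (int i) \<omega>))"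

lemma prob_vimage: "S \<in> sets borel \<Longrightarrow> prob (X i -` S \<inter> space M) = measure D S"
  using measure_distr[OF rv, of S i] by (simp add: distr)

lemma freq_measurable [measurable]:
  assumes [measurable]: "S \<in> sets borel"
  shows "freq n S \<in> borel_measurable M"
  unfolding freq_def[abs_def] by measurable

lemma mixing_coeff_nonneg: "0 \<le> mixing_coeff M X k"
proof -
  have "{} \<in> gen_events M X I" for I
    unfolding gen_events_def by (rule sigma_sets.Empty)
  then show ?thesis
    using mixing_bound[OF rv, where A = "{}" and B = "{}" and m = 0] by simp
qed

text \<open>Besides the mixing coefficient, the covariance of two indicators of probability \<open>q\<close> is bounded
  by \<open>q\<close> itself; this extra bound makes the variance of small empirical increments negligible.\<close>

definition cov_bound :: "real \<Rightarrow> nat \<Rightarrow> real" where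
  "cov_bound q k = min q (if k = 0 then 1 else mixing_coeff M X k)"

lemma cov_bound_nonneg: "0 \<le> q \<Longrightarrow> 0 \<le> cov_bound q k"
  by (simp add: cov_bound_def mixing_coeff_nonneg)

lemma cov_bound_le: "cov_bound q k \<le> (if k = 0 then 1 else mixing_coeff M X k)"
  unfolding cov_bound_def by (rule min.cobounded2)

text \<open>The summability assumption starts at lag 1; at lag 0 the trivial variance bound 1 takes
  the place of the coefficient.\<close>

lemma summable_cov_majorant: "summable (\<lambda>k. if k = 0 then 1 else mixing_coeff M X k)"
  by (subst summable_Suc_iff[symmetric]) (simp add: summable_mixing)

lemma summable_cov_bound: "0 \<le> q \<Longrightarrow> summable (cov_bound q)"
  by (rule summable_comparison_test[OF _ summable_cov_majorant])
     (use cov_bound_nonneg cov_bound_le in \<open>auto intro!: exI[of _ 0] simp del: abs_le_iff\<close>)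

text \<open>Dominated convergence for counting measure: each term is at most \<open>q n\<close> and
  so tends to 0, while the mixing coefficients dominate the terms uniformly in
  \<open>n\<close>.\<close>

lemma suminf_cov_bound_tendsto_0:
  assumes "q \<longlonglongrightarrow> 0" and "\<And>n. 0 \<le> q n"
  shows "(\<lambda>n. suminf (cov_bound (q n))) \<longlonglongrightarrow> 0"
proof -
  let ?w = "\<lambda>k. if k = 0 then 1 else mixing_coeff M X k"
  have sums: "(\<integral>k. cov_bound (q n) k \<partial>count_space UNIV) = suminf (cov_bound (q n))" for n
    using summable_cov_bound[OF assms(2)] cov_bound_nonneg[OF assms(2)]
    by (intro integral_count_space_nat) (simp add: integrable_count_space_nat_iff)
  have "(\<lambda>n. \<integral>k. cov_bound (q n) k \<partial>count_space UNIV) \<longlonglongrightarrow> (\<integral>k. 0 \<partial>count_space (UNIV :: nat set))"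
  proof (rule integral_dominated_convergence)
    show "AE k in count_space UNIV. (\<lambda>n. cov_bound (q n) k) \<longlonglongrightarrow> 0"
    proof (intro AE_I2)
      show "(\<lambda>n. cov_bound (q n) k) \<longlonglongrightarrow> 0" for k
        by (rule tendsto_sandwich[OF _ _ tendsto_const assms(1)])
           (auto simp: cov_bound_nonneg assms(2) cov_bound_def mixing_coeff_nonneg)
    qed
    show "integrable (count_space UNIV) ?w"
      using summable_cov_majorant by (simp add: integrable_count_space_nat_iff mixing_coeff_nonneg cong: if_cong)
    show "AE k in count_space UNIV. norm (cov_bound (q n) k) \<le> ?w k" for n
      using cov_bound_nonneg[OF assms(2)] cov_bound_le by (intro AE_I2) (metis abs_of_nonneg real_norm_def)
  qed auto
  then show ?thesis by (simp add: sums)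
qed

text \<open>The covariance equals \<open>prob (A i \<inter> A j) - q * q\<close>. Monotonicity
  bounds it by \<open>q\<close>, and mixing bounds it by the coefficient at lag
  \<open>j - i\<close>. An upper bound suffices, since covariances are only summed to bound a second
  moment from above.\<close>

lemma covariance_indicator_le:
  assumes S [measurable]: "S \<in> sets borel" and ij: "1 \<le> i" "i \<le> j"
  defines "q \<equiv> measure D S"
  shows "expectation (\<lambda>\<omega>. (indicator S (X (int i) \<omega>) - q) * (indicator S (X (int j) \<omega>) - q))
    \<le> cov_bound q (j - i)"
proof -
  define A where "A k = X (int k) -` S \<inter> space M" for k
  have A [measurable]: "A k \<in> events" for k
    unfolding A_def by measurable
  have pA: "prob (A k) = q" for k
    by (simp add: A_def q_def prob_vimage)
  have q: "0 \<le> q" "q \<le> 1"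
    by (simp_all add: q_def)
  have "expectation (\<lambda>\<omega>. (indicator S (X (int i) \<omega>) - q) * (indicator S (X (int j) \<omega>) - q))
      = expectation (\<lambda>\<omega>. indicator (A i \<inter> A j) \<omega> - q * indicator (A i) \<omega> - q * indicator (A j) \<omega> + q * q)"
    by (intro Bochner_Integration.integral_cong) (auto simp: A_def indicator_def algebra_simps)
  also have "\<dots> = prob (A i \<inter> A j) - q * q"
  proof -
    have int: "integrable M (indicator B :: 'a \<Rightarrow> real)" if "B \<in> events" for B
      using that by (intro integrable_const_bound[of _ 1]) (auto simp: indicator_def)
    have E: "expectation (indicator B) = prob B" if "B \<in> events" for B
      using that by (simp add: Int_absorb2 sets.sets_into_space)
    have AA: "A i \<inter> A j \<in> events"
      using A[of i] A[of j] by (rule sets.Int)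
    show ?thesis
      using int[OF A[of i]] int[OF A[of j]] int[OF AA]
      by (simp add: E[OF A[of i]] E[OF A[of j]] E[OF AA] pA prob_space del: integral_indicator)
  qed
  also have "\<dots> \<le> cov_bound q (j - i)"
  proof -
    have "prob (A i \<inter> A j) \<le> q"
      using finite_measure_mono[of "A i \<inter> A j" "A i"] pA by simp
    then have "prob (A i \<inter> A j) - q * q \<le> q" "prob (A i \<inter> A j) - q * q \<le> 1"
      using q mult_nonneg_nonneg[of q q] by linarith+
    moreover have "prob (A i \<inter> A j) - q * q \<le> mixing_coeff M X (j - i)"
    proof -
      \<comment> \<open>The path is cut at time \<open>i\<close>: the past \<open>{1..int i}\<close>
        contains \<open>i\<close> because \<open>1 \<le> i\<close>, and the future at lag
        \<open>j - i\<close> begins exactly at \<open>j\<close>.\<close>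
      have "A i \<in> gen_events M X {1..int i}" "A j \<in> gen_events M X {int i + int (j - i)..}"
        using S ij unfolding gen_events_def A_def
        by (auto intro!: sigma_sets.Basic exI[of _ S] simp: of_nat_diff)
      from mixing_bound[OF rv this] show ?thesis
        by (simp add: pA)
    qed
    ultimately show ?thesis
      by (simp add: cov_bound_def)
  qed
  finally show ?thesis .
qed

text \<open>Expanding the square gives \<open>n\<close> rows of covariances, and each row sums to at
  most twice the series of covariance bounds.\<close>

lemma expectation_sum_squared_le:
  assumes S [measurable]: "S \<in> sets borel"
  defines "q \<equiv> measure D S"
  shows "expectation (\<lambda>\<omega>. (\<Sum>i = 1..n. indicator S (X (int i) \<omega>) - q)\<^sup>2)
    \<le> 2 * real n * suminf (cov_bound q)"
proof -
  let ?Z = "\<lambda>i \<omega>. indicator S (X (int i) \<omega>) - q"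
  have q: "0 \<le> q" "q \<le> 1"
    by (simp_all add: q_def)
  have int: "integrable M (\<lambda>\<omega>. ?Z i \<omega> * ?Z j \<omega>)" for i j
  proof (rule integrable_const_bound[of _ 1])
    have "\<bar>?Z i \<omega> * ?Z j \<omega>\<bar> \<le> 1 * 1" for \<omega>
      unfolding abs_mult using q by (intro mult_mono) (auto simp: indicator_def)
    then show "AE \<omega> in M. norm (?Z i \<omega> * ?Z j \<omega>) \<le> 1"
      by simp
  qed measurable
  have *: "expectation (\<lambda>\<omega>. ?Z i \<omega> * ?Z j \<omega>) \<le> cov_bound q (if i \<le> j then j - i else i - j)"
    if "1 \<le> i" "1 \<le> j" for i j
    using covariance_indicator_le[OF S, of i j] covariance_indicator_le[OF S, of j i] that
    by (auto simp: q_def mult.commute)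
  have "expectation (\<lambda>\<omega>. (\<Sum>i = 1..n. ?Z i \<omega>)\<^sup>2) = (\<Sum>i = 1..n. \<Sum>j = 1..n. expectation (\<lambda>\<omega>. ?Z i \<omega> * ?Z j \<omega>))"
    unfolding power2_eq_square sum_product using int
    by (subst Bochner_Integration.integral_sum) (auto intro!: sum.cong Bochner_Integration.integral_sum)
  also have "\<dots> \<le> (\<Sum>i = 1..n. \<Sum>j = 1..n. cov_bound q (if i \<le> j then j - i else i - j))"
    using * by (intro sum_mono) auto
  also have "\<dots> \<le> (\<Sum>i = 1..n. 2 * (\<Sum>k<n. cov_bound q k))"
    using q cov_bound_nonneg by (intro sum_mono sum_distance_le) auto
  also have "\<dots> \<le> (\<Sum>i = 1..n. 2 * suminf (cov_bound q))"
    using q cov_bound_nonneg by (intro sum_mono mult_left_mono sum_le_suminf summable_cov_bound) auto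
  finally show ?thesis by (simp add: mult_ac)
qed

text \<open>Chebyshev's inequality for the number of visits to \<open>S\<close>. The linear growth
  of its variance cancels against the normalisation by \<open>sqrt n\<close>, so the bound depends
  on \<open>S\<close> but not on \<open>n\<close>.\<close>

lemma freq_deviation:
  assumes S [measurable]: "S \<in> sets borel" and "1 \<le> n" "0 < a"
  defines "q \<equiv> measure D S"
  shows "prob {\<omega> \<in> space M. a \<le> sqrt (real n) * \<bar>freq n S \<omega> - q\<bar>} \<le> 2 * suminf (cov_bound q) / a\<^sup>2"
proof -
  let ?Y = "\<lambda>\<omega>. \<Sum>i = 1..n. indicator S (X (int i) \<omega>) :: real"
  have EY: "expectation ?Y = n * q"
  proof -
    have "expectation (\<lambda>\<omega>. indicator S (X i \<omega>)) = q" for i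
    proof -
      have "expectation (\<lambda>\<omega>. indicator S (X i \<omega>)) = expectation (indicator (X i -` S \<inter> space M))"
        by (intro Bochner_Integration.integral_cong) (auto simp: indicator_def)
      also have "\<dots> = q"
        using prob_vimage[OF S, of i] by (simp add: q_def)
      finally show ?thesis .
    qed
    then show ?thesis
      by (subst Bochner_Integration.integral_sum)
         (auto intro!: integrable_const_bound[of _ 1] simp: indicator_def)
  qed
  have int: "integrable M (\<lambda>\<omega>. (?Y \<omega>)\<^sup>2)"
  proof (rule integrable_const_bound[of _ "(real n)\<^sup>2"])
    have "0 \<le> ?Y \<omega>" "?Y \<omega> \<le> (\<Sum>i = 1..n. 1)" for \<omega>
      by (intro sum_nonneg sum_mono; simp add: indicator_def)+
    then show "AE \<omega> in M. norm ((?Y \<omega>)\<^sup>2) \<le> (real n)\<^sup>2"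
      by (simp add: power_mono)
  qed measurable
  have sqrt: "sqrt (real n) * \<bar>freq n S \<omega> - q\<bar> = \<bar>?Y \<omega> - n * q\<bar> / sqrt (real n)" for \<omega>
  proof -
    have "freq n S \<omega> - q = (?Y \<omega> - n * q) / n"
      using \<open>1 \<le> n\<close> by (simp add: freq_def field_simps)
    then show ?thesis
      by (simp add: abs_divide real_sqrt_mult_self flip: real_divide_square_eq[of "sqrt (real n)"])
  qed
  have "prob {\<omega> \<in> space M. a \<le> sqrt (real n) * \<bar>freq n S \<omega> - q\<bar>}
      = prob {\<omega> \<in> space M. a * sqrt (real n) \<le> \<bar>?Y \<omega> - expectation ?Y\<bar>}"
    using \<open>1 \<le> n\<close> unfolding sqrt EY by (simp add: pos_le_divide_eq)
  also have "\<dots> \<le> variance ?Y / (a * sqrt (real n))\<^sup>2"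
    using \<open>1 \<le> n\<close> \<open>0 < a\<close> int by (intro Chebyshev_inequality) auto
  also have "variance ?Y = expectation (\<lambda>\<omega>. (\<Sum>i = 1..n. indicator S (X (int i) \<omega>) - q)\<^sup>2)"
    unfolding EY by (simp add: sum_subtractf)
  also have "\<dots> / (a * sqrt (real n))\<^sup>2 \<le> 2 * real n * suminf (cov_bound q) / (a * sqrt (real n))\<^sup>2"
    unfolding q_def using expectation_sum_squared_le[OF S] by (intro divide_right_mono) auto
  also have "\<dots> = 2 * suminf (cov_bound q) / a\<^sup>2"
    using \<open>1 \<le> n\<close> by (simp add: power_mult_distrib)
  finally show ?thesis .
qed

lemma freq_Ioc: "a \<le> b \<Longrightarrow> freq n {a<..b} \<omega> = empirical_cdf X n \<omega> b - empirical_cdf X n \<omega> a"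
  unfolding freq_def empirical_cdf_def right_diff_distrib[symmetric] sum_subtractf[symmetric]
  by (intro arg_cong2[of _ _ _ _ "(*)"] sum.cong) (auto simp: indicator_def)

lemma empirical_cdf_measurable [measurable]: "(\<lambda>\<omega>. empirical_cdf X n \<omega> t) \<in> borel_measurable M"
  unfolding empirical_cdf_def by measurable

text \<open>The infimum runs over uncountably many points, but inversion turns each sublevel set
  into an event about the empirical cdf at one point.\<close>

lemma empirical_quantile_measurable:
  assumes "0 < p" "p \<le> 1" "n \<ge> 1"
  shows "(\<lambda>\<omega>. quantile (empirical_cdf X n \<omega>) p) \<in> borel_measurable M"
  unfolding borel_measurable_iff_le empirical_quantile_le_iff[OF assms] by measurable

end

section \<open>Convergence of inverses in probability\<close>

text \<open>On the event \<open>\<bar>V n\<bar> < K\<close>, any deviation of \<open>U n\<close> from \<open>\<phi> (V n)\<close> by \<open>\<epsilon>\<close> forces \<open>W x n\<close> to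
  miss \<open>g x\<close> by a fixed amount at some point \<open>x\<close> of a finite grid of mesh \<open>\<epsilon> / 2\<close>.\<close>

lemma (in prob_space) inverse_tendsto_in_prob:
  fixes U V :: "nat \<Rightarrow> 'a \<Rightarrow> real" and W :: "real \<Rightarrow> nat \<Rightarrow> 'a \<Rightarrow> real" and g \<phi> :: "real \<Rightarrow> real"
  assumes V [measurable]: "\<And>n. V n \<in> borel_measurable M"
    and W [measurable]: "\<And>x n. W x n \<in> borel_measurable M"
    and g: "strict_mono g" and g_\<phi>: "\<And>v. g (\<phi> v) = v"
    and tight: "\<And>\<delta>. 0 < \<delta> \<Longrightarrow> \<exists>K. \<forall>n\<ge>1. prob {\<omega> \<in> space M. K \<le> \<bar>V n \<omega>\<bar>} \<le> \<delta>"
    and W_lim: "\<And>x \<eta>. 0 < \<eta> \<Longrightarrow> (\<lambda>n. prob {\<omega> \<in> space M. \<eta> \<le> \<bar>W x n \<omega> - g x\<bar>}) \<longlonglongrightarrow> 0"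
    and iff: "\<And>x n \<omega>. 1 \<le> n \<Longrightarrow> \<omega> \<in> space M \<Longrightarrow> U n \<omega> \<le> x \<longleftrightarrow> V n \<omega> \<le> W x n \<omega>"
    and "0 < \<epsilon>"
  shows "(\<lambda>n. prob {\<omega> \<in> space M. \<epsilon> < \<bar>U n \<omega> - \<phi> (V n \<omega>)\<bar>}) \<longlonglongrightarrow> 0"
proof (rule order_tendstoI)
  fix \<delta> :: real assume "\<delta> < 0"
  then show "\<forall>\<^sub>F n in sequentially. \<delta> < prob {\<omega> \<in> space M. \<epsilon> < \<bar>U n \<omega> - \<phi> (V n \<omega>)\<bar>}"
    by (intro always_eventually allI) (rule less_le_trans[OF _ measure_nonneg])
next
  fix \<delta> :: real assume "0 < \<delta>"
  define a where "a = \<epsilon> / 2"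
  have a: "0 < a" "\<epsilon> = 2 * a"
    using \<open>0 < \<epsilon>\<close> by (simp_all add: a_def)
  \<comment> \<open>Half of \<open>\<delta>\<close> pays for the tail of \<open>V n\<close>, the
    other half for the grid events.\<close>
  obtain K where K: "\<And>n. 1 \<le> n \<Longrightarrow> prob {\<omega> \<in> space M. K \<le> \<bar>V n \<omega>\<bar>} \<le> \<delta> / 2"
    using tight[of "\<delta> / 2"] \<open>0 < \<delta>\<close> by auto
  \<comment> \<open>The margins -1 and +2 ensure that \<open>J\<close> contains both indices chosen
    below, for every value \<open>v\<close> between \<open>\<phi> (- K)\<close> and
    \<open>\<phi> K\<close>. It is finite and independent of \<open>n\<close> and
    \<open>\<omega>\<close>.\<close>
  define J where "J = {\<lfloor>\<phi> (- K) / a\<rfloor> - 1..\<lfloor>\<phi> K / a\<rfloor> + 2}"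
  define x where "x j = of_int j * a" for j :: int
  \<comment> \<open>The smaller of the increments of \<open>g\<close> over the two cells adjacent to
    \<open>x j\<close>.\<close>
  define \<eta> where "\<eta> j = min (g (x j) - g (x j - a)) (g (x j + a) - g (x j))" for j
  define E where "E n j = {\<omega> \<in> space M. \<eta> j \<le> \<bar>W (x j) n \<omega> - g (x j)\<bar>}" for n j
  have \<eta>: "0 < \<eta> j" for j
    unfolding \<eta>_def using strict_monoD[OF g] a by simp
  have E [measurable]: "E n j \<in> events" for n j
    unfolding E_def by measurable
  have sub: "{\<omega> \<in> space M. \<epsilon> < \<bar>U n \<omega> - \<phi> (V n \<omega>)\<bar>}
      \<subseteq> {\<omega> \<in> space M. K \<le> \<bar>V n \<omega>\<bar>} \<union> (\<Union>j\<in>J. E n j)" if n: "1 \<le> n" for n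
  proof safe
    fix \<omega> assume \<omega>: "\<omega> \<in> space M" and far: "\<epsilon> < \<bar>U n \<omega> - \<phi> (V n \<omega>)\<bar>" and notin: "\<omega> \<notin> (\<Union>j\<in>J. E n j)"
    show "K \<le> \<bar>V n \<omega>\<bar>"
    proof (rule ccontr)
      assume "\<not> K \<le> \<bar>V n \<omega>\<bar>"
      then have VK: "- K < V n \<omega>" "V n \<omega> < K" by linarith+
      define v where "v = \<phi> (V n \<omega>)"
      have gv: "g v = V n \<omega>"
        by (simp add: v_def g_\<phi>)
      have "\<phi> (- K) \<le> v" "v \<le> \<phi> K"
        using VK strict_mono_less[OF g] g_\<phi> gv by (metis less_imp_le)+
      then have range: "\<phi> (- K) / a \<le> v / a" "v / a \<le> \<phi> K / a"
        using a by (simp_all add: divide_right_mono)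
      have fl: "of_int \<lfloor>v / a\<rfloor> * a \<le> v" "v < of_int \<lfloor>v / a\<rfloor> * a + a"
        using a floor_divide_lower[of a v] floor_divide_upper[of a v] by (simp_all add: algebra_simps)
      consider "v + \<epsilon> < U n \<omega>" | "U n \<omega> < v - \<epsilon>"
        using far unfolding v_def by linarith
      then have "\<exists>j\<in>J. \<omega> \<in> E n j"
      proof cases
        case 1
        \<comment> \<open>The offset 2 puts \<open>x j\<close> more than one mesh to the right of
          \<open>v\<close> but not beyond \<open>v + \<epsilon>\<close>. Then
          \<open>x j < U n \<omega>\<close> gives
          \<open>W (x j) n \<omega> < g v < g (x j - a)\<close>, a miss of at least
          \<open>\<eta> j\<close>.\<close>
        define j where "j = \<lfloor>v / a\<rfloor> + 2"
        have j: "j \<in> J"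
          using floor_mono[OF range(1)] floor_mono[OF range(2)] by (simp add: J_def j_def)
        have xj: "v + a < x j" "x j \<le> v + \<epsilon>"
          using fl a by (simp_all add: x_def j_def algebra_simps)
        then have "\<not> V n \<omega> \<le> W (x j) n \<omega>"
          using 1 iff[OF n \<omega>, of "x j"] by linarith
        moreover have "g v < g (x j - a)"
          using xj by (intro strict_monoD[OF g]) simp
        ultimately have "\<omega> \<in> E n j"
          using gv \<omega> unfolding E_def \<eta>_def by auto
        then show ?thesis using j by blast
      next
        case 2
        \<comment> \<open>Mirror image: \<open>x j\<close> lies at least one mesh to the left of
          \<open>v\<close> but not below \<open>v - \<epsilon>\<close>, so
          \<open>W (x j) n \<omega>\<close> is at least \<open>g (x j + a)\<close>.\<close>
        define j where "j = \<lfloor>v / a\<rfloor> - 1"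
        have j: "j \<in> J"
          using floor_mono[OF range(1)] floor_mono[OF range(2)] by (simp add: J_def j_def)
        have xj: "x j + a \<le> v" "v - \<epsilon> \<le> x j"
          using fl a by (simp_all add: x_def j_def algebra_simps)
        then have "V n \<omega> \<le> W (x j) n \<omega>"
          using 2 iff[OF n \<omega>, of "x j"] by linarith
        moreover have "g (x j + a) \<le> g v"
          using xj by (simp add: strict_mono_less_eq[OF g])
        ultimately have "\<omega> \<in> E n j"
          using gv \<omega> unfolding E_def \<eta>_def by auto
        then show ?thesis using j by blast
      qed
      then show False using notin by blast
    qed
  qed
  have "finite J"
    by (simp add: J_def)
  have le: "prob {\<omega> \<in> space M. \<epsilon> < \<bar>U n \<omega> - \<phi> (V n \<omega>)\<bar>} \<le> \<delta> / 2 + (\<Sum>j\<in>J. prob (E n j))"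
    if n: "1 \<le> n" for n
  proof -
    have meas: "{\<omega> \<in> space M. K \<le> \<bar>V n \<omega>\<bar>} \<in> events" "(\<Union>j\<in>J. E n j) \<in> events"
      using \<open>finite J\<close> by measurable
    have "prob {\<omega> \<in> space M. \<epsilon> < \<bar>U n \<omega> - \<phi> (V n \<omega>)\<bar>}
        \<le> prob ({\<omega> \<in> space M. K \<le> \<bar>V n \<omega>\<bar>} \<union> (\<Union>j\<in>J. E n j))"
      using sub[OF n] meas by (intro finite_measure_mono) auto
    also have "\<dots> \<le> prob {\<omega> \<in> space M. K \<le> \<bar>V n \<omega>\<bar>} + prob (\<Union>j\<in>J. E n j)"
      using meas by (intro measure_Un_le) auto
    also have "prob (\<Union>j\<in>J. E n j) \<le> (\<Sum>j\<in>J. prob (E n j))"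
      using \<open>finite J\<close> E by (intro measure_UNION_le) auto
    finally show ?thesis using K[OF n] by linarith
  qed
  have "(\<lambda>n. \<Sum>j\<in>J. prob (E n j)) \<longlonglongrightarrow> (\<Sum>j\<in>J. 0)"
    unfolding E_def by (intro tendsto_sum W_lim \<eta>)
  then have "\<forall>\<^sub>F n in sequentially. (\<Sum>j\<in>J. prob (E n j)) < \<delta> / 2"
    using \<open>0 < \<delta>\<close> by (intro order_tendstoD(2)) auto
  then show "\<forall>\<^sub>F n in sequentially. prob {\<omega> \<in> space M. \<epsilon> < \<bar>U n \<omega> - \<phi> (V n \<omega>)\<bar>} < \<delta>"
    using eventually_ge_at_top[of 1]
  proof eventually_elim
    case (elim n)
    then show ?case using le[of n] by linarith
  qed
qed

section \<open>Signed powers\<close>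

text \<open>The leading term of the quantile expansion is thus the inverse of the limit
  \<open>g\<close> of the scaled increments.\<close>

lemma signed_powr_inverse:
  fixes m \<rho> v :: real
  assumes "0 < m" "0 < \<rho>"
  defines "u \<equiv> (\<bar>v\<bar> / m) powr (1 / \<rho>) * sgn v"
  shows "m * \<bar>u\<bar> powr \<rho> * sgn u = v"
proof (cases "v = 0")
  case False
  have "\<bar>u\<bar> = (\<bar>v\<bar> / m) powr (1 / \<rho>)" "sgn u = sgn v"
    using assms(1) False by (simp_all add: u_def abs_mult abs_sgn_eq sgn_mult)
  moreover have "((\<bar>v\<bar> / m) powr (1 / \<rho>)) powr \<rho> = \<bar>v\<bar> / m"
    using assms(1,2) by (simp add: powr_powr)
  ultimately show ?thesis
    using assms(1) by (simp add: abs_mult_sgn)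
qed (simp add: u_def)

lemma strict_mono_signed_powr:
  fixes m \<rho> :: real
  assumes "0 < m" "0 < \<rho>"
  shows "strict_mono (\<lambda>x. m * \<bar>x\<bar> powr \<rho> * sgn x)"
proof (rule strict_monoI)
  fix x y :: real assume "x < y"
  consider "0 \<le> x" | "y \<le> 0" | "x < 0" "0 < y" by linarith
  then show "m * \<bar>x\<bar> powr \<rho> * sgn x < m * \<bar>y\<bar> powr \<rho> * sgn y"
  proof cases
    case 1
    then show ?thesis
      using assms \<open>x < y\<close> powr_less_mono2[of \<rho> x y] by (cases "x = 0") auto
  next
    case 2
    then show ?thesis
      using assms \<open>x < y\<close> powr_less_mono2[of \<rho> "- y" "- x"] by (cases "y = 0") auto
  next
    case 3
    then have "m * \<bar>x\<bar> powr \<rho> * sgn x < 0" "0 < m * \<bar>y\<bar> powr \<rho> * sgn y"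
      using assms by (auto simp: mult_less_0_iff)
    then show ?thesis by linarith
  qed
qed

text \<open>The quotient form will be evaluated along a null sequence to find the mean of
  \<open>W x n\<close>; continuity yields \<open>cdf D t = p\<close>. The sign stays inside the
  limit because the one-sided limits of the quotient differ when
  \<open>m \<noteq> 0\<close>.\<close>

lemma signed_powr_expansion:
  fixes F :: "real \<Rightarrow> real"
  assumes "0 < \<rho>"
    and "(\<lambda>h. F (t + h) - F t - m * \<bar>h\<bar> powr \<rho> * sgn h) \<in> o[at 0](\<lambda>h. \<bar>h\<bar> powr \<rho>)"
  shows signed_powr_expansion_quotient:
      "((\<lambda>h. (F (t + h) - F t) / \<bar>h\<bar> powr \<rho> - m * sgn h) \<longlongrightarrow> 0) (at 0)"
    and signed_powr_expansion_isCont: "isCont F t"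
proof -
  have "((\<lambda>h. (F (t + h) - F t - m * \<bar>h\<bar> powr \<rho> * sgn h) / \<bar>h\<bar> powr \<rho>) \<longlongrightarrow> 0) (at 0)"
    using assms(2) by (rule smalloD_tendsto)
  then show lim: "((\<lambda>h. (F (t + h) - F t) / \<bar>h\<bar> powr \<rho> - m * sgn h) \<longlongrightarrow> 0) (at 0)"
    by (rule Lim_transform_eventually) (auto simp: eventually_at_filter diff_divide_distrib)
  have pow: "((\<lambda>h::real. \<bar>h\<bar> powr \<rho>) \<longlongrightarrow> 0) (at 0)"
    using assms(1) by (intro tendsto_eq_intros | simp)+
  have "((\<lambda>h. \<bar>h\<bar> powr \<rho> * (m * sgn h)) \<longlongrightarrow> 0) (at 0)"
  proof (rule Lim_null_comparison)
    show "\<forall>\<^sub>F h in at 0. norm (\<bar>h\<bar> powr \<rho> * (m * sgn h)) \<le> \<bar>h\<bar> powr \<rho> * \<bar>m\<bar>"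
      by (auto simp: abs_mult abs_sgn_eq)
    show "((\<lambda>h. \<bar>h\<bar> powr \<rho> * \<bar>m\<bar>) \<longlongrightarrow> 0) (at 0)"
      using tendsto_mult_right[OF pow, of "\<bar>m\<bar>"] by simp
  qed
  from tendsto_add[OF tendsto_mult[OF pow lim] this]
  have sum: "((\<lambda>h. \<bar>h\<bar> powr \<rho> * ((F (t + h) - F t) / \<bar>h\<bar> powr \<rho> - m * sgn h)
      + \<bar>h\<bar> powr \<rho> * (m * sgn h)) \<longlongrightarrow> 0) (at 0)"
    by simp
  have alg: "r * (a / r - b) + r * b = a" if "r \<noteq> 0" for r a b :: real
    using that by (simp add: field_simps)
  have "((\<lambda>h. F (t + h) - F t) \<longlongrightarrow> 0) (at 0)"
    by (rule Lim_transform_eventually[OF sum]) (simp add: eventually_at_filter alg)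
  then show "isCont F t"
    unfolding isCont_iff by (rule Lim_null[THEN iffD2])
qed

text \<open>The right-hand difference quotients of a nondecreasing function are nonnegative, and
  they converge to \<open>m\<close>.\<close>

lemma signed_powr_expansion_pos:
  fixes F :: "real \<Rightarrow> real"
  assumes "mono F" "0 < \<rho>" "m \<noteq> 0"
    and "(\<lambda>h. F (t + h) - F t - m * \<bar>h\<bar> powr \<rho> * sgn h) \<in> o[at 0](\<lambda>h. \<bar>h\<bar> powr \<rho>)"
  shows "0 < m"
proof -
  have "((\<lambda>h. (F (t + h) - F t) / \<bar>h\<bar> powr \<rho> - m * sgn h) \<longlongrightarrow> 0) (at_right 0)"
    using signed_powr_expansion_quotient[OF assms(2,4)] by (simp add: filterlim_at_split)
  then have "((\<lambda>h. (F (t + h) - F t) / \<bar>h\<bar> powr \<rho> - m) \<longlongrightarrow> 0) (at_right 0)"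
    by (rule Lim_transform_eventually) (auto simp: eventually_at_filter)
  then have "((\<lambda>h. (F (t + h) - F t) / \<bar>h\<bar> powr \<rho>) \<longlongrightarrow> m) (at_right 0)"
    by (rule Lim_null[THEN iffD2])
  then have "0 \<le> m"
  proof (rule tendsto_lowerbound)
    show "\<forall>\<^sub>F h in at_right 0. 0 \<le> (F (t + h) - F t) / \<bar>h\<bar> powr \<rho>"
      using monoD[OF \<open>mono F\<close>] by (auto simp: eventually_at_filter)
  qed simp
  then show ?thesis using \<open>m \<noteq> 0\<close> by simp
qed

section \<open>The empirical quantile\<close>

context mixing_sequence
begin

text \<open>The step \<open>h n\<close> is scaled so that \<open>\<bar>h n\<bar> powr \<rho>\<close>
  is of order \<open>1 / sqrt n\<close>; hence the mean of the scaled increment converges. Its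
  fluctuation concerns an interval of probability \<open>q n\<close>, which tends to 0, so the
  variance bound vanishes.\<close>

lemma empirical_increment_tendsto:
  assumes "0 < \<rho>" "0 < \<eta>"
    and exp: "(\<lambda>h. cdf D (t + h) - cdf D t - m * \<bar>h\<bar> powr \<rho> * sgn h) \<in> o[at 0](\<lambda>h. \<bar>h\<bar> powr \<rho>)"
  shows "(\<lambda>n. prob {\<omega> \<in> space M. \<eta> \<le> \<bar>sqrt (real n) *
      (empirical_cdf X n \<omega> (t + x / real n powr (1 / (2 * \<rho>))) - empirical_cdf X n \<omega> t)
      - m * \<bar>x\<bar> powr \<rho> * sgn x\<bar>}) \<longlonglongrightarrow> 0"
proof (cases "x = 0")
  case True
  then show ?thesis using \<open>0 < \<eta>\<close> by simp
next
  case False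
  define h where "h n = x / real n powr (1 / (2 * \<rho>))" for n :: nat
  \<comment> \<open>The interval between \<open>t\<close> and \<open>t + h n\<close> for either sign
    of \<open>h n\<close>; the orientation is carried by \<open>sgn (h n)\<close>.\<close>
  define S where "S n = {min t (t + h n)<..max t (t + h n)}" for n
  define q where "q n = measure D (S n)" for n
  have h_pos: "sgn (h n) = sgn x" "h n \<noteq> 0" "\<bar>h n\<bar> powr \<rho> = \<bar>x\<bar> powr \<rho> / sqrt (real n)"
    if "1 \<le> n" for n
  proof -
    have "0 < real n powr (1 / (2 * \<rho>))"
      using that by simp
    then show "sgn (h n) = sgn x" "h n \<noteq> 0"
      using False by (simp_all add: h_def sgn_divide)
    have "\<bar>h n\<bar> powr \<rho> = \<bar>x\<bar> powr \<rho> / (real n powr (1 / (2 * \<rho>))) powr \<rho>"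
      by (simp add: h_def abs_divide powr_divide)
    also have "(real n powr (1 / (2 * \<rho>))) powr \<rho> = real n powr (1 / 2)"
      using \<open>0 < \<rho>\<close> by (simp add: powr_powr)
    finally show "\<bar>h n\<bar> powr \<rho> = \<bar>x\<bar> powr \<rho> / sqrt (real n)"
      by (simp add: powr_half_sqrt)
  qed
  have h_lim: "h \<longlonglongrightarrow> 0"
  proof -
    have "(\<lambda>n::nat. x * real n powr - (1 / (2 * \<rho>))) \<longlonglongrightarrow> x * 0"
      by (rule tendsto_mult_left[OF tendsto_neg_powr[OF _ filterlim_real_sequentially]])
        (use \<open>0 < \<rho>\<close> in simp)
    moreover have "h = (\<lambda>n::nat. x * real n powr - (1 / (2 * \<rho>)))"
      by (simp only: h_def powr_minus_divide times_divide_eq_right mult_1_right fun_eq_iff simp_thms)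
    ultimately show ?thesis by (simp only: mult_zero_right)
  qed
  have cdf_lim: "(\<lambda>n. cdf D (t + h n)) \<longlonglongrightarrow> cdf D t"
  proof (rule isCont_tendsto_compose[OF signed_powr_expansion_isCont[OF \<open>0 < \<rho>\<close> exp]])
    show "(\<lambda>n. t + h n) \<longlonglongrightarrow> t"
      using tendsto_add[OF tendsto_const[of t] h_lim] by simp
  qed
  have q_cdf: "cdf D (t + h n) - cdf D t = sgn (h n) * q n" for n
    using D.cdf_diff_eq[of t "t + h n"] D.cdf_diff_eq[of "t + h n" t]
    by (cases "h n" "0::real" rule: linorder_cases) (simp_all add: q_def S_def)
  have freq_S: "empirical_cdf X n \<omega> (t + h n) - empirical_cdf X n \<omega> t = sgn (h n) * freq n (S n) \<omega>" for n \<omega>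
    using freq_Ioc[of t "t + h n" n \<omega>] freq_Ioc[of "t + h n" t n \<omega>]
    by (cases "h n" "0::real" rule: linorder_cases) (simp_all add: S_def)
  have S: "S n \<in> sets borel" for n
    by (simp add: S_def)
  have q_nonneg: "0 \<le> q n" for n
    by (simp add: q_def)
  have "(\<lambda>n. \<bar>cdf D (t + h n) - cdf D t\<bar>) \<longlonglongrightarrow> 0"
    using tendsto_rabs[OF tendsto_diff[OF cdf_lim tendsto_const[of "cdf D t"]]] by simp
  then have q_lim: "q \<longlonglongrightarrow> 0"
    by (rule Lim_transform_eventually)
      (use h_pos q_nonneg in \<open>auto simp: q_cdf abs_mult abs_sgn_eq eventually_sequentially intro!: exI[of _ 1]\<close>)
  have mean: "(\<lambda>n. sqrt (real n) * (sgn x * q n)) \<longlonglongrightarrow> m * \<bar>x\<bar> powr \<rho> * sgn x"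
  proof -
    have "filterlim h (at 0) sequentially"
      using h_lim h_pos(2) by (auto simp: filterlim_at eventually_sequentially intro!: exI[of _ 1])
    from filterlim_compose[OF signed_powr_expansion_quotient[OF \<open>0 < \<rho>\<close> exp] this]
    have "(\<lambda>n. \<bar>x\<bar> powr \<rho> * ((cdf D (t + h n) - cdf D t) / \<bar>h n\<bar> powr \<rho> - m * sgn (h n))) \<longlonglongrightarrow> 0"
      by (rule tendsto_mult_right_zero)
    then have "(\<lambda>n. sqrt (real n) * (sgn x * q n) - m * \<bar>x\<bar> powr \<rho> * sgn x) \<longlonglongrightarrow> 0"
    proof (rule Lim_transform_eventually)
      show "\<forall>\<^sub>F n in sequentially.
          \<bar>x\<bar> powr \<rho> * ((cdf D (t + h n) - cdf D t) / \<bar>h n\<bar> powr \<rho> - m * sgn (h n)) =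
          sqrt (real n) * (sgn x * q n) - m * \<bar>x\<bar> powr \<rho> * sgn x"
        using eventually_ge_at_top[of 1]
      proof eventually_elim
        case (elim n)
        then show ?case
          using False unfolding q_cdf h_pos[OF elim] by (simp add: field_simps)
      qed
    qed
    then show ?thesis by (rule Lim_null[THEN iffD2])
  qed
  \<comment> \<open>Half of \<open>\<eta>\<close> absorbs the error of the mean; the other half is
    left to the random deviation.\<close>
  have "\<forall>\<^sub>F n in sequentially. \<bar>sqrt (real n) * (sgn x * q n) - m * \<bar>x\<bar> powr \<rho> * sgn x\<bar> < \<eta> / 2"
    using mean \<open>0 < \<eta>\<close> by (auto dest!: tendstoD[of _ _ _ "\<eta> / 2"] simp: dist_real_def)
  then have bound: "\<forall>\<^sub>F n in sequentially. prob {\<omega> \<in> space M. \<eta> \<le> \<bar>sqrt (real n) *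
      (empirical_cdf X n \<omega> (t + h n) - empirical_cdf X n \<omega> t) - m * \<bar>x\<bar> powr \<rho> * sgn x\<bar>}
      \<le> 2 * suminf (cov_bound (q n)) / (\<eta> / 2)\<^sup>2"
    using eventually_ge_at_top[of 1]
  proof eventually_elim
    case (elim n)
    have "\<eta> / 2 \<le> sqrt (real n) * \<bar>freq n (S n) \<omega> - q n\<bar>"
      if "\<eta> \<le> \<bar>sqrt (real n) * (sgn x * freq n (S n) \<omega>) - m * \<bar>x\<bar> powr \<rho> * sgn x\<bar>" for \<omega>
    proof -
      have "sqrt (real n) * \<bar>freq n (S n) \<omega> - q n\<bar>
          = \<bar>sqrt (real n) * (sgn x * freq n (S n) \<omega>) - sqrt (real n) * (sgn x * q n)\<bar>"
        using False by (simp add: abs_mult abs_sgn_eq flip: right_diff_distrib)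
      then show ?thesis using that elim(1) by linarith
    qed
    then have "prob {\<omega> \<in> space M. \<eta> \<le> \<bar>sqrt (real n) *
      (empirical_cdf X n \<omega> (t + h n) - empirical_cdf X n \<omega> t) - m * \<bar>x\<bar> powr \<rho> * sgn x\<bar>}
      \<le> prob {\<omega> \<in> space M. \<eta> / 2 \<le> sqrt (real n) * \<bar>freq n (S n) \<omega> - q n\<bar>}"
      using freq_measurable[OF S] unfolding freq_S h_pos(1)[OF elim(2)]
      by (intro finite_measure_mono) auto
    also have "\<dots> \<le> 2 * suminf (cov_bound (q n)) / (\<eta> / 2)\<^sup>2"
      unfolding q_def using S elim(2) \<open>0 < \<eta>\<close> by (intro freq_deviation) auto
    finally show ?case .
  qed
  have "(\<lambda>n. 2 * suminf (cov_bound (q n)) / (\<eta> / 2)\<^sup>2) \<longlonglongrightarrow> 2 * 0 / (\<eta> / 2)\<^sup>2"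
    using \<open>0 < \<eta>\<close> by (intro tendsto_intros suminf_cov_bound_tendsto_0 q_lim q_nonneg) auto
  then have lim: "(\<lambda>n. 2 * suminf (cov_bound (q n)) / (\<eta> / 2)\<^sup>2) \<longlonglongrightarrow> 0"
    by simp
  show ?thesis
    by (rule tendsto_sandwich[OF _ bound[unfolded h_def] tendsto_const lim]) simp
qed

lemma empirical_cdf_tight:
  assumes "0 < \<delta>"
  shows "\<exists>K. \<forall>n\<ge>1. prob {\<omega> \<in> space M. K \<le> \<bar>sqrt (real n) * (cdf D t - empirical_cdf X n \<omega> t)\<bar>} \<le> \<delta>"
proof -
  define C where "C = suminf (cov_bound (measure D {..t}))"
  have "0 \<le> C"
    unfolding C_def by (intro suminf_nonneg summable_cov_bound cov_bound_nonneg) auto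
  \<comment> \<open>Chosen to make the Chebyshev bound \<open>2 * C / K\<^sup>2\<close> at most
    \<open>\<delta>\<close>; the added 1 keeps \<open>K\<close> positive when
    \<open>C = 0\<close>.\<close>
  define K where "K = sqrt (2 * (C + 1) / \<delta>)"
  have K: "0 < K" "K\<^sup>2 = 2 * (C + 1) / \<delta>"
    using \<open>0 \<le> C\<close> \<open>0 < \<delta>\<close> by (simp_all add: K_def)
  have "prob {\<omega> \<in> space M. K \<le> \<bar>sqrt (real n) * (cdf D t - empirical_cdf X n \<omega> t)\<bar>} \<le> \<delta>" if "1 \<le> n" for n
  proof -
    have "prob {\<omega> \<in> space M. K \<le> \<bar>sqrt (real n) * (cdf D t - empirical_cdf X n \<omega> t)\<bar>} \<le> 2 * C / K\<^sup>2"
      using freq_deviation[of "{..t}" n K] that K(1)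
      by (simp add: C_def abs_mult cdf_def freq_def empirical_cdf_def abs_minus_commute)
    also have "\<dots> \<le> \<delta>"
      using \<open>0 \<le> C\<close> \<open>0 < \<delta>\<close> by (simp add: K(2) field_simps)
    finally show ?thesis .
  qed
  then show ?thesis by blast
qed

lemma empirical_quantile_expansion:
  fixes p m \<rho> :: real
  assumes "0 < p" "p < 1" "0 < \<rho>" "m \<noteq> 0"
  defines "t \<equiv> quantile (cdf D) p"
  assumes exp: "(\<lambda>h. cdf D (t + h) - cdf D t - m * \<bar>h\<bar> powr \<rho> * sgn h) \<in> o[at 0](\<lambda>h. \<bar>h\<bar> powr \<rho>)"
  defines "\<phi> \<equiv> \<lambda>v. (\<bar>v\<bar> / m) powr (1 / \<rho>) * sgn v"
  shows "tendsto_in_prob M (\<lambda>n \<omega>. real n powr (1 / (2 * \<rho>)) *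
    (quantile (empirical_cdf X n \<omega>) p - t - \<phi> (p - empirical_cdf X n \<omega> t))) (\<lambda>_. 0)"
proof -
  let ?s = "\<lambda>n::nat. real n powr (1 / (2 * \<rho>))"
  have "mono (cdf D)"
    by (simp add: monoI D.cdf_nondecreasing)
  have m: "0 < m"
    by (rule signed_powr_expansion_pos[OF \<open>mono (cdf D)\<close> \<open>0 < \<rho>\<close> \<open>m \<noteq> 0\<close> exp])
  have Ft: "cdf D t = p"
    unfolding t_def using \<open>0 < p\<close> \<open>p < 1\<close> signed_powr_expansion_isCont[OF \<open>0 < \<rho>\<close> exp]
    by (intro cdf_quantile_eq D.real_distribution_axioms) (simp_all add: t_def)
  define V where "V n \<omega> = sqrt (real n) * (p - empirical_cdf X n \<omega> t)" for n \<omega>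
  define W where "W x n \<omega> = sqrt (real n) * (empirical_cdf X n \<omega> (t + x / ?s n) - empirical_cdf X n \<omega> t)"
    for x n \<omega>
  \<comment> \<open>Since \<open>\<phi>\<close> is homogeneous of degree \<open>1 / \<rho>\<close>
    under positive scaling, the factor \<open>sqrt n\<close> inside becomes the factor
    \<open>n powr (1 / (2 * \<rho>))\<close> outside.\<close>
  have \<phi>_scale: "?s n * \<phi> (p - empirical_cdf X n \<omega> t) = \<phi> (V n \<omega>)" if "1 \<le> n" for n \<omega>
  proof -
    have "(sqrt (real n) * y / m) powr (1 / \<rho>) = ?s n * (y / m) powr (1 / \<rho>)" if "0 \<le> y" for y
    proof -
      have "(sqrt (real n) * y / m) powr (1 / \<rho>) = sqrt (real n) powr (1 / \<rho>) * (y / m) powr (1 / \<rho>)"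
        using m that by (simp flip: powr_mult)
      then show ?thesis
        by (simp add: powr_powr flip: powr_half_sqrt)
    qed
    then show ?thesis
      using that by (simp add: \<phi>_def V_def abs_mult sgn_mult)
  qed
  have iff: "?s n * (quantile (empirical_cdf X n \<omega>) p - t) \<le> x \<longleftrightarrow> V n \<omega> \<le> W x n \<omega>" if n: "1 \<le> n" for x n \<omega>
  proof -
    have "?s n * (quantile (empirical_cdf X n \<omega>) p - t) \<le> x
        \<longleftrightarrow> quantile (empirical_cdf X n \<omega>) p \<le> t + x / ?s n"
      using n by (simp add: field_simps)
    also have "\<dots> \<longleftrightarrow> p \<le> empirical_cdf X n \<omega> (t + x / ?s n)"
      using \<open>0 < p\<close> \<open>p < 1\<close> n by (intro empirical_quantile_le_iff) auto
    also have "\<dots> \<longleftrightarrow> V n \<omega> \<le> W x n \<omega>"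
      using n by (simp add: V_def W_def)
    finally show ?thesis .
  qed
  have lim: "(\<lambda>n. prob {\<omega> \<in> space M. \<epsilon> < \<bar>?s n * (quantile (empirical_cdf X n \<omega>) p - t) - \<phi> (V n \<omega>)\<bar>})
      \<longlonglongrightarrow> 0" if "0 < \<epsilon>" for \<epsilon>
  proof (rule inverse_tendsto_in_prob[where W = W and V = V and \<phi> = \<phi>
        and g = "\<lambda>x. m * \<bar>x\<bar> powr \<rho> * sgn x"])
    show "m * \<bar>\<phi> v\<bar> powr \<rho> * sgn (\<phi> v) = v" for v
      unfolding \<phi>_def by (rule signed_powr_inverse[OF m \<open>0 < \<rho>\<close>])
    show "\<exists>K. \<forall>n\<ge>1. prob {\<omega> \<in> space M. K \<le> \<bar>V n \<omega>\<bar>} \<le> \<delta>" if "0 < \<delta>" for \<delta>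
      using empirical_cdf_tight[OF that, of t] by (simp add: V_def Ft)
    show "(\<lambda>n. prob {\<omega> \<in> space M. \<eta> \<le> \<bar>W x n \<omega> - m * \<bar>x\<bar> powr \<rho> * sgn x\<bar>}) \<longlonglongrightarrow> 0" if "0 < \<eta>" for x \<eta>
      unfolding W_def by (rule empirical_increment_tendsto[OF \<open>0 < \<rho>\<close> that exp])
    show "V n \<in> borel_measurable M" "W x n \<in> borel_measurable M" for x n
      unfolding V_def[abs_def] W_def[abs_def] by measurable
  qed (use iff that strict_mono_signed_powr[OF m \<open>0 < \<rho>\<close>] in simp_all)
  show ?thesis
    unfolding tendsto_in_prob_def
  proof (intro conjI allI impI)
    fix n
    show "(\<lambda>\<omega>. ?s n * (quantile (empirical_cdf X n \<omega>) p - t - \<phi> (p - empirical_cdf X n \<omega> t)))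
        \<in> borel_measurable M"
    \<comment> \<open>For \<open>n = 0\<close> the factor \<open>0 powr (1 / (2 * \<rho>))\<close>
      is 0, so the function is constant.\<close>
    proof (cases "n = 0")
      case False
      then have [measurable]: "(\<lambda>\<omega>. quantile (empirical_cdf X n \<omega>) p) \<in> borel_measurable M"
        using \<open>0 < p\<close> \<open>p < 1\<close> by (intro empirical_quantile_measurable) auto
      show ?thesis
        unfolding \<phi>_def by measurable
    qed simp
  next
    fix \<epsilon> :: real assume "0 < \<epsilon>"
    show "(\<lambda>n. prob {\<omega> \<in> space M. \<epsilon> < \<bar>?s n *
        (quantile (empirical_cdf X n \<omega>) p - t - \<phi> (p - empirical_cdf X n \<omega> t)) - 0\<bar>}) \<longlonglongrightarrow> 0"
    proof (rule Lim_transform_eventually[OF lim[OF \<open>0 < \<epsilon>\<close>]])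
      show "\<forall>\<^sub>F n in sequentially.
          prob {\<omega> \<in> space M. \<epsilon> < \<bar>?s n * (quantile (empirical_cdf X n \<omega>) p - t) - \<phi> (V n \<omega>)\<bar>} =
          prob {\<omega> \<in> space M. \<epsilon> < \<bar>?s n *
            (quantile (empirical_cdf X n \<omega>) p - t - \<phi> (p - empirical_cdf X n \<omega> t)) - 0\<bar>}"
        using eventually_ge_at_top[of 1]
        by eventually_elim (simp add: \<phi>_scale[symmetric] right_diff_distrib)
    qed
  qed simp
qed

end

theorem theorem1:
  fixes P :: "'a measure" and X :: "int \<Rightarrow> 'a \<Rightarrow> real"
    and F :: "real \<Rightarrow> real" and p t\<^sub>p \<rho> M :: real
  assumes "prob_space P"
    and "\<And>n. X n \<in> borel_measurable P"
    and "0 < p" and "p < 1"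
    and "strictly_stationary P X"
    and "strongly_mixing P X"
    and "\<And>n. cdf (distr P borel (X n)) = F"
    and "t\<^sub>p = quantile F p"
    and "\<rho> > 0" and "M \<noteq> 0"
    and "(\<lambda>h. F (t\<^sub>p + h) - F t\<^sub>p - M * \<bar>h\<bar> powr \<rho> * sgn h) \<in> o[at 0](\<lambda>h. \<bar>h\<bar> powr \<rho>)"
    and "summable (\<lambda>n. mixing_coeff P X (Suc n))"
  shows "\<exists>R :: nat \<Rightarrow> 'a \<Rightarrow> real.
    (\<forall>n\<ge>1. \<forall>\<omega>\<in>space P.
       quantile (empirical_cdf X n \<omega>) p - t\<^sub>p =
         (\<bar>p - empirical_cdf X n \<omega> t\<^sub>p\<bar> / M) powr (1 / \<rho>) * sgn (p - empirical_cdf X n \<omega> t\<^sub>p)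
         + R n \<omega>) \<and>
    tendsto_in_prob P (\<lambda>n \<omega>. real n powr (1 / (2 * \<rho>)) * R n \<omega>) (\<lambda>_. 0)"
proof -
  interpret P: prob_space P by fact
  \<comment> \<open>Any index would do: all terms have the cdf \<open>F\<close>, and a cdf
    determines its law.\<close>
  define D where "D = distr P borel (X 0)"
  have cdf_D: "cdf D = F"
    by (simp add: D_def assms(7))
  interpret mixing_sequence P X D
  proof
    show "distr P borel (X i) = D" for i
      unfolding D_def using assms(2,7)
      by (intro cdf_unique P.real_distribution_distr) auto
  qed (use assms(2,12) in auto)
  show ?thesis
    using empirical_quantile_expansion[of p \<rho> M] assms(3,4,8-11)
    \<comment> \<open>The remainder is defined as the difference of the two sides, so only its
      convergence has content.\<close>
    by (intro exI[of _ "\<lambda>n \<omega>. quantile (empirical_cdf X n \<omega>) p - t\<^sub>p -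
        (\<bar>p - empirical_cdf X n \<omega> t\<^sub>p\<bar> / M) powr (1 / \<rho>) * sgn (p - empirical_cdf X n \<omega> t\<^sub>p)"])
      (simp add: cdf_D)
qed

end
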